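(* Let $K$ be an algebraically closed field, let $m,n\ge 1$, and let $p\in K\langle x_1,\dots,x_n\rangle$ be a polynomial in non-commutative variables with zero constant term and with $\mathrm{ord}(p)=t$. Then the following hold. (1) If $t=0$, then $p(T_m(K))$ is Zariski dense in $T_m(K)$. (2) If $t=1$, then $p(T_m(K))=T_m(K)^{(0)}$. (3) If $1<t<m-1$, then $p(T_m(K))\subseteq T_m(K)^{(t-1)}$. Equality does not hold in general: there exist $m,n,t$ with $1<t<m-1$ and a polynomial $p$ with zero constant term in $n$ non-commutative variables with $\mathrm{ord}(p)=t$ such that $p(T_m(K))\neq T_m(K)^{(t-1)}$. Furthermore, for every $m$ and $t$ with $1<t<m-1$ there exists a positive integer $d=d(m,t)$ such that, for every $n\ge 1$ and every polynomial $p\in K\langle x_1,\dots,x_n\rangle$ with zero constant term and with $\mathrm{ord}(p)=t$, each element of $T_m(K)^{(t-1)}$ can be written as a sum of $d$ elements of $p(T_m(K))$. (4) If $t=m-1$, then $p(T_m(K))=T_m(K)^{(m-2)}$. (5) If $t\ge m$, then $p(T_m(K))=\{0\}$.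
   Context: $T_m(K)$ is the algebra of $m\times m$ upper triangular matrices over $K$ (so $T_1(K)=K$). $T_m(K)^{(s)}$ denotes the set of matrices in $T_m(K)$ whose $(i,j)$ entry is $0$ whenever $j-i\le s$. $K\langle x_1,\dots,x_n\rangle$ is the free associative algebra, i.e. polynomials in non-commuting variables. For a $K$-algebra $A$, $p(A)=\{p(a_1,\dots,a_n): a_1,\dots,a_n\in A\}$ is the image of the evaluation map, and $p$ is a polynomial identity of $A$ if $p(A)=\{0\}$. Order: $\mathrm{ord}(p)=0$ if $p(K)\ne\{0\}$; for $t\ge 1$, $\mathrm{ord}(p)=t$ if $p$ is a polynomial identity of $T_t(K)$ but not of $T_{t+1}(K)$. $T_m(K)$ is identified with affine space $K^{m(m+1)/2}$ with its Zariski topology. *)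

theory Defs
  imports
    "HOL-Library.Poly_Mapping"
    "HOL-Computational_Algebra.Polynomial"
    "HOL-Analysis.Abstract_Topology"
    "Jordan_Normal_Form.Matrix"
begin

subsection \<open>Upper triangular matrices\<close>

definition triangular_mats :: "nat \<Rightarrow> 'a::zero mat set" where
  "triangular_mats m = {A \<in> carrier_mat m m. upper_triangular A}"

text \<open>The index \<open>s\<close> is an integer because \<open>s = -1\<close> does occur (as \<open>m - 2\<close> for \<open>m = 1\<close>); in that
  case the condition is vacuous on upper triangular matrices.\<close>

definition triangular_mats_shift :: "nat \<Rightarrow> int \<Rightarrow> 'a::zero mat set" where
  "triangular_mats_shift m s =
     {A \<in> triangular_mats m. \<forall>i<m. \<forall>j<m. int j - int i \<le> s \<longrightarrow> A $$ (i, j) = 0}"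


subsection \<open>Polynomials in non-commuting variables\<close>

text \<open>An element of \<open>K\<langle>x\<^sub>1,\<dots>,x\<^sub>n\<rangle>\<close> is a finitely supported family of coefficients indexed by the
  words in the letters \<open>0,\<dots>,n-1\<close>; the constant term is the coefficient of the empty word.\<close>

definition free_algebra :: "nat \<Rightarrow> (nat list \<Rightarrow>\<^sub>0 'a::zero) set" where
  "free_algebra n = {p. \<forall>w \<in> Poly_Mapping.keys p. set w \<subseteq> {..<n}}"

definition eval_word :: "nat \<Rightarrow> (nat \<Rightarrow> 'a::semiring_1 mat) \<Rightarrow> nat list \<Rightarrow> 'a mat" where
  "eval_word m a w = foldr (\<lambda>i M. a i * M) w (1\<^sub>m m)"

text \<open>The sum over the support of \<open>p\<close> is taken entrywise, as the type of all matrices of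
  arbitrary shape is not an additive monoid.\<close>

definition eval_poly :: "nat \<Rightarrow> (nat list \<Rightarrow>\<^sub>0 'a::semiring_1) \<Rightarrow> (nat \<Rightarrow> 'a mat) \<Rightarrow> 'a mat" where
  "eval_poly m p a =
     mat m m (\<lambda>(i, j). \<Sum>w\<in>Poly_Mapping.keys p. Poly_Mapping.lookup p w * eval_word m a w $$ (i, j))"

definition poly_image :: "nat \<Rightarrow> nat \<Rightarrow> (nat list \<Rightarrow>\<^sub>0 'a::semiring_1) \<Rightarrow> 'a mat set" where
  "poly_image n m p = {eval_poly m p a | a. \<forall>i<n. a i \<in> triangular_mats m}"

definition poly_identity :: "nat \<Rightarrow> nat \<Rightarrow> (nat list \<Rightarrow>\<^sub>0 'a::semiring_1) \<Rightarrow> bool" where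
  "poly_identity n m p \<longleftrightarrow> poly_image n m p = {0\<^sub>m m m}"

text \<open>The order is a relation rather than a function, since some polynomials (such as \<open>0\<close>) have no
  order. The field \<open>K\<close> is identified with the algebra of \<open>1 \<times> 1\<close> matrices.\<close>

definition has_order :: "nat \<Rightarrow> (nat list \<Rightarrow>\<^sub>0 'a::semiring_1) \<Rightarrow> nat \<Rightarrow> bool" where
  "has_order n p t \<longleftrightarrow>
     (if t = 0 then poly_image n 1 p \<noteq> {0\<^sub>m 1 1}
      else poly_identity n t p \<and> \<not> poly_identity n (t + 1) p)"


subsection \<open>The Zariski topology on upper triangular matrices\<close>

text \<open>Polynomial functions in the \<open>m(m+1)/2\<close> entries on and above the diagonal.\<close>

inductive_set entry_polys :: "nat \<Rightarrow> ('a::comm_semiring_1 mat \<Rightarrow> 'a) set" for m :: nat where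
  const: "(\<lambda>A. c) \<in> entry_polys m"
| entry: "i \<le> j \<Longrightarrow> j < m \<Longrightarrow> (\<lambda>A. A $$ (i, j)) \<in> entry_polys m"
| add: "f \<in> entry_polys m \<Longrightarrow> g \<in> entry_polys m \<Longrightarrow> (\<lambda>A. f A + g A) \<in> entry_polys m"
| mult: "f \<in> entry_polys m \<Longrightarrow> g \<in> entry_polys m \<Longrightarrow> (\<lambda>A. f A * g A) \<in> entry_polys m"

definition zero_locus :: "nat \<Rightarrow> ('a::comm_semiring_1 mat \<Rightarrow> 'a) set \<Rightarrow> 'a mat set" where
  "zero_locus m F = {A \<in> triangular_mats m. \<forall>f\<in>F. f A = 0}"

definition zariski_topology :: "nat \<Rightarrow> 'a::idom mat topology" where
  "zariski_topology m =
     topology (\<lambda>U. \<exists>F. F \<subseteq> entry_polys m \<and> U = triangular_mats m - zero_locus m F)"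

lemma openin_zariski_topology:
  "openin (zariski_topology m) U \<longleftrightarrow>
     (\<exists>F. F \<subseteq> entry_polys m \<and> U = triangular_mats m - zero_locus m F)"
proof -
  let ?P = "\<lambda>U :: 'a mat set. \<exists>F. F \<subseteq> entry_polys m \<and> U = triangular_mats m - zero_locus m F"
  have "?P (U \<inter> V)" if "?P U" "?P V" for U V
  proof -
    from that obtain F G where F: "F \<subseteq> entry_polys m" "U = triangular_mats m - zero_locus m F"
      and G: "G \<subseteq> entry_polys m" "V = triangular_mats m - zero_locus m G" by blast
    define H where "H = (\<Union>f\<in>F. (\<lambda>g A. f A * g A) ` G)"
    have "H \<subseteq> entry_polys m"
    proof
      fix h assume "h \<in> H"
      then obtain f g where fg: "h = (\<lambda>A. f A * g A)" "f \<in> F" "g \<in> G"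
        unfolding H_def by blast
      from F(1) fg(2) have "f \<in> entry_polys m" by (rule subsetD)
      moreover from G(1) fg(3) have "g \<in> entry_polys m" by (rule subsetD)
      ultimately show "h \<in> entry_polys m" unfolding fg(1) by (rule entry_polys.mult)
    qed
    moreover have "U \<inter> V = triangular_mats m - zero_locus m H"
    proof (rule Set.set_eqI)
      fix A
      have "(\<exists>h\<in>H. h A \<noteq> 0) \<longleftrightarrow> (\<exists>f\<in>F. \<exists>g\<in>G. f A * g A \<noteq> 0)"
        by (simp add: H_def)
      also have "\<dots> \<longleftrightarrow> (\<exists>f\<in>F. f A \<noteq> 0) \<and> (\<exists>g\<in>G. g A \<noteq> 0)"
        by simp
      finally have *: "(\<exists>h\<in>H. h A \<noteq> 0) \<longleftrightarrow> (\<exists>f\<in>F. f A \<noteq> 0) \<and> (\<exists>g\<in>G. g A \<noteq> 0)" .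
      have diff: "A \<in> triangular_mats m - zero_locus m F' \<longleftrightarrow>
              A \<in> triangular_mats m \<and> (\<exists>f\<in>F'. f A \<noteq> 0)" for F'
        unfolding zero_locus_def by blast
      show "A \<in> U \<inter> V \<longleftrightarrow> A \<in> triangular_mats m - zero_locus m H"
        unfolding F(2) G(2) Int_iff diff * by (rule iffI) simp_all
    qed
    ultimately show ?thesis by blast
  qed
  moreover have "?P (\<Union>\<U>)" if "\<forall>U\<in>\<U>. ?P U" for \<U>
  proof -
    from that obtain F where F: "\<And>U. U \<in> \<U> \<Longrightarrow> F U \<subseteq> entry_polys m"
        "\<And>U. U \<in> \<U> \<Longrightarrow> U = triangular_mats m - zero_locus m (F U)"
      by metis
    have "\<Union>\<U> = (\<Union>U\<in>\<U>. triangular_mats m - zero_locus m (F U))"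
      using F(2) by (metis (no_types, lifting) SUP_cong SUP_identity_eq)
    also have "\<dots> = triangular_mats m - zero_locus m (\<Union>U\<in>\<U>. F U)"
      by (auto simp: zero_locus_def)
    finally have "\<Union>\<U> = triangular_mats m - zero_locus m (\<Union>U\<in>\<U>. F U)" .
    moreover have "(\<Union>U\<in>\<U>. F U) \<subseteq> entry_polys m"
      using F(1) by (rule UN_least)
    ultimately show ?thesis by (intro exI conjI)
  qed
  ultimately have "istopology ?P"
    unfolding istopology_def by (intro conjI allI impI)
  then show ?thesis
    unfolding zariski_topology_def by simp
qed

lemma topspace_zariski_topology [simp]: "topspace (zariski_topology m) = triangular_mats m"
proof (rule antisym)
  show "topspace (zariski_topology m) \<subseteq> (triangular_mats m :: 'a mat set)"
    unfolding topspace_def openin_zariski_topology by blast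
  have "triangular_mats m = triangular_mats m - zero_locus m {\<lambda>A. 1 :: 'a}"
    by (auto simp: zero_locus_def)
  then have "openin (zariski_topology m) (triangular_mats m :: 'a mat set)"
    unfolding openin_zariski_topology by (intro exI[of _ "{\<lambda>A. 1}"]) (auto intro: entry_polys.const)
  then show "(triangular_mats m :: 'a mat set) \<subseteq> topspace (zariski_topology m)"
    by (rule openin_subset)
qed

lemma closedin_zariski_topology:
  "closedin (zariski_topology m) C \<longleftrightarrow> (\<exists>F. F \<subseteq> entry_polys m \<and> C = zero_locus m F)"
proof -
  have "zero_locus m F \<subseteq> triangular_mats m" for F :: "('a mat \<Rightarrow> 'a) set"
    by (auto simp: zero_locus_def)
  then show ?thesis
    unfolding closedin_def topspace_zariski_topology openin_zariski_topology
    by (metis Diff_Diff_Int Diff_subset inf.absorb_iff2)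
qed

definition zariski_dense :: "nat \<Rightarrow> 'a::idom mat set \<Rightarrow> bool" where
  "zariski_dense m X \<longleftrightarrow> Abstract_Topology.closure_of (zariski_topology m) X = triangular_mats m"


subsection \<open>Sums of matrices\<close>

definition mat_list_sum :: "nat \<Rightarrow> 'a::monoid_add mat list \<Rightarrow> 'a mat" where
  "mat_list_sum m Bs = foldr (+) Bs (0\<^sub>m m m)"

end

theory Submission
  imports Defs
begin

text \<open>
  The value of \<open>p\<close> at upper triangular matrices has as its entry at \<open>(i, j)\<close> a sum over weakly
  increasing paths from \<open>i\<close> to \<open>j\<close>. Such an entry involves only the arguments in the rows and columns
  \<open>i, \<dots>, j\<close>, and as a function of these it depends only on \<open>j - i\<close>. Therefore \<open>p\<close> has order \<open>t\<close> iff
  the superdiagonals \<open>0, \<dots>, t - 1\<close> of all values vanish and the \<open>t\<close>-th does not (\<open>has_order_iff\<close>).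
  This gives the inclusion of the image in \<open>T\<^sub>m(K)\<^bsup>(t-1)\<^esup>\<close> and its vanishing for \<open>t \<ge> m\<close>. Two ideas
  produce values.

  \<^item> If \<open>t \<ge> 1\<close>, the values on \<open>T\<^bsub>t+1\<^esub>(K)\<close> are multiples of the corner unit, and by diagonal
    conjugation all multiples occur. Embedding \<open>T\<^bsub>t+1\<^esub>(K)\<close> into \<open>T\<^sub>m(K)\<close> along \<open>t + 1\<close> increasing
    indices shows that every \<open>c E\<^sub>i\<^sub>j\<close> with \<open>j - i \<ge> t\<close> is a value of \<open>p\<close>
    (\<open>single_entry_in_poly_image\<close>). For \<open>t = m - 1\<close> this is the whole of \<open>T\<^sub>m(K)\<^bsup>(m-2)\<^esup>\<close>, and in
    general it writes each element of \<open>T\<^sub>m(K)\<^bsup>(t-1)\<^esup>\<close> as a sum of \<open>m\<^sup>2\<close> values.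

  \<^item> For \<open>t \<le> 1\<close> one fixes points \<open>z\<^sub>0, \<dots>, z\<^bsub>m-1\<^esub>\<close> of \<open>K\<^sup>n\<close> as the diagonals of the arguments and solves
    for their remaining entries, one superdiagonal after the other. The entry of the value at
    \<open>(i, j)\<close> is affine in the arguments at \<open>(i, j)\<close>, and the linear part is a skew derivation of \<open>p\<close>
    that involves \<open>z\<^sub>i\<close> and \<open>z\<^sub>j\<close> only; it is enough that this derivation does not vanish
    (\<open>poly_entry_prescribe\<close>). If \<open>t = 0\<close>, the inner derivation has the value \<open>p(z\<^sub>j) - p(z\<^sub>i)\<close>, and \<open>p\<close>
    maps \<open>K\<^sup>n\<close> onto \<open>K\<close>; so all triangular matrices with distinct diagonal entries are values, and
    these are Zariski dense. If \<open>t = 1\<close>, the derivation is nonzero at some pair of points because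
    \<open>p\<close> is not an identity of \<open>T\<^sub>2(K)\<close>, hence for every two points of a generic \<open>m\<close>-tuple, and all
    strictly triangular matrices are values.

  Equality fails for the square of a commutator on \<open>T\<^sub>5(K)\<close>: the second superdiagonal of a value has
  the form \<open>(c\<^sub>0 c\<^sub>1, c\<^sub>1 c\<^sub>2, c\<^sub>2 c\<^sub>3)\<close>, which is never \<open>(1, 0, 1)\<close>.
\<close>

section \<open>Evaluation as a sum over weakly increasing paths\<close>

text \<open>The linear extension to the free algebra of a function given on words. Scalar evaluation, the
matrix entries of an evaluation and the skew derivations below are all of this form.\<close>

definition word_sum :: "(nat list \<Rightarrow>\<^sub>0 'a::comm_ring_1) \<Rightarrow> (nat list \<Rightarrow> 'a) \<Rightarrow> 'a" where
  "word_sum p f = (\<Sum>w\<in>Poly_Mapping.keys p. Poly_Mapping.lookup p w * f w)"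

lemma word_sum_cong:
  assumes "\<And>w. w \<in> Poly_Mapping.keys p \<Longrightarrow> f w = g w"
  shows "word_sum p f = word_sum p g"
  unfolding word_sum_def using assms by (intro sum.cong) auto

lemma word_sum_add: "word_sum p (\<lambda>w. f w + g w) = word_sum p f + word_sum p g"
  unfolding word_sum_def by (simp add: algebra_simps sum.distrib)

lemma word_sum_diff: "word_sum p (\<lambda>w. f w - g w) = word_sum p f - word_sum p g"
  unfolding word_sum_def by (simp add: algebra_simps sum_subtractf)

lemma word_sum_cmult: "word_sum p (\<lambda>w. c * f w) = c * word_sum p f"
  unfolding word_sum_def by (simp add: sum_distrib_left algebra_simps)

lemma word_sum_superset:
  assumes "finite S" "Poly_Mapping.keys p \<subseteq> S"
  shows "word_sum p f = (\<Sum>w\<in>S. Poly_Mapping.lookup p w * f w)"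
  unfolding word_sum_def
  by (rule sum.mono_neutral_left) (use assms in \<open>auto simp: in_keys_iff\<close>)

text \<open>The entry at \<open>(i, j)\<close> of the product \<open>a l\<^sub>1 \<cdots> a l\<^sub>k\<close> of upper triangular matrices, as a sum over
the weakly increasing paths from \<open>i\<close> to \<open>j\<close>. Summing over \<open>{i..j}\<close> only has two advantages over
the matrix product: no size \<open>m\<close> occurs, so that evaluations on \<open>T\<^sub>m(K)\<close> for different \<open>m\<close> are
restrictions of one object, and any family \<open>a\<close> may be inserted, as its entries below the diagonal
are never looked at.\<close>

primrec word_entry ::
  "(nat \<Rightarrow> nat \<Rightarrow> nat \<Rightarrow> 'a::comm_ring_1) \<Rightarrow> nat list \<Rightarrow> nat \<Rightarrow> nat \<Rightarrow> 'a" where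
  "word_entry a [] i j = of_bool (i = j)"
| "word_entry a (l # w) i j = (\<Sum>k=i..j. a l i k * word_entry a w k j)"

definition poly_entry ::
  "(nat \<Rightarrow> nat \<Rightarrow> nat \<Rightarrow> 'a::comm_ring_1) \<Rightarrow> (nat list \<Rightarrow>\<^sub>0 'a) \<Rightarrow> nat \<Rightarrow> nat \<Rightarrow> 'a" where
  "poly_entry a p i j = word_sum p (\<lambda>w. word_entry a w i j)"

lemma word_entry_below_diagonal: "j < i \<Longrightarrow> word_entry a w i j = 0"
  by (cases w) auto

lemma word_entry_cong:
  assumes "\<And>l r s. l \<in> set w \<Longrightarrow> i \<le> r \<Longrightarrow> r \<le> s \<Longrightarrow> s \<le> j \<Longrightarrow> a l r s = b l r s"
  shows "word_entry a w i j = word_entry b w i j"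
  using assms by (induction w arbitrary: i) (auto intro!: sum.cong)

text \<open>An entry depends only on the triangle of arguments between it and the diagonal. This is what makes
it possible to determine the arguments one superdiagonal at a time.\<close>

lemma poly_entry_cong:
  assumes "\<And>l r s. i \<le> r \<Longrightarrow> r \<le> s \<Longrightarrow> s \<le> j \<Longrightarrow> a l r s = b l r s"
  shows "poly_entry a p i j = poly_entry b p i j"
  unfolding poly_entry_def using assms by (intro word_sum_cong word_entry_cong)

lemma word_entry_diag: "word_entry a w i i = prod_list (map (\<lambda>l. a l i i) w)"
  by (induction w) auto

lemma word_entry_shift:
  "word_entry (\<lambda>l r s. a l (r + d) (s + d)) w i j = word_entry a w (i + d) (j + d)"
proof (induction w arbitrary: i)
  case (Cons l w)
  have "(\<Sum>k=i + d..j + d. a l (i + d) k * word_entry a w k (j + d)) =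
      (\<Sum>k=i..j. a l (i + d) (k + d) * word_entry a w (k + d) (j + d))"
    by (rule sum.shift_bounds_cl_nat_ivl)
  with Cons show ?case by simp
qed simp

lemma poly_entry_shift:
  "poly_entry (\<lambda>l r s. a l (r + d) (s + d)) p i j = poly_entry a p (i + d) (j + d)"
  unfolding poly_entry_def word_entry_shift ..

text \<open>Evaluation commutes with conjugation, here by the diagonal matrix with entries \<open>c\<close>.\<close>

lemma word_entry_diagonal_conjugate:
  fixes a :: "nat \<Rightarrow> nat \<Rightarrow> nat \<Rightarrow> 'a::field"
  assumes "\<And>r. c r \<noteq> 0"
  shows "word_entry (\<lambda>l r s. c r * a l r s / c s) w i j = c i / c j * word_entry a w i j"
  using assms by (induction w arbitrary: i) (auto simp: sum_distrib_left intro!: sum.cong)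

lemma poly_entry_diagonal_conjugate:
  fixes a :: "nat \<Rightarrow> nat \<Rightarrow> nat \<Rightarrow> 'a::field"
  assumes "\<And>r. c r \<noteq> 0"
  shows "poly_entry (\<lambda>l r s. c r * a l r s / c s) p i j = c i / c j * poly_entry a p i j"
  unfolding poly_entry_def word_entry_diagonal_conjugate[OF assms] by (rule word_sum_cmult)

lemma eval_word_triangular:
  assumes "\<And>l. l \<in> set w \<Longrightarrow> A l \<in> triangular_mats m"
  shows "eval_word m A w \<in> carrier_mat m m \<and>
    (\<forall>i<m. \<forall>j<m. eval_word m A w $$ (i, j) = word_entry (\<lambda>l r s. A l $$ (r, s)) w i j)"
  using assms
proof (induction w)
  case Nil
  then show ?case by (auto simp: eval_word_def)
next
  case (Cons l w)
  let ?M = "eval_word m A w" and ?a = "\<lambda>l r s. A l $$ (r, s)"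
  have IH: "?M \<in> carrier_mat m m"
    "\<And>i j. i < m \<Longrightarrow> j < m \<Longrightarrow> ?M $$ (i, j) = word_entry ?a w i j"
    using Cons by auto
  have A: "A l \<in> carrier_mat m m" "upper_triangular (A l)"
    using Cons.prems by (auto simp: triangular_mats_def)
  have eq: "eval_word m A (l # w) = A l * ?M"
    by (simp add: eval_word_def)
  have "(A l * ?M) $$ (i, j) = word_entry ?a (l # w) i j" if "i < m" "j < m" for i j
  proof -
    have "(A l * ?M) $$ (i, j) = (\<Sum>k=0..<m. A l $$ (i, k) * word_entry ?a w k j)"
      using that A IH by (auto simp: scalar_prod_def intro!: sum.cong)
    also have "\<dots> = (\<Sum>k=i..j. A l $$ (i, k) * word_entry ?a w k j)"
    proof (rule sum.mono_neutral_right)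
      show "\<forall>k\<in>{0..<m} - {i..j}. A l $$ (i, k) * word_entry ?a w k j = 0"
      proof
        fix k assume k: "k \<in> {0..<m} - {i..j}"
        then consider "k < i" | "j < k" by force
        then show "A l $$ (i, k) * word_entry ?a w k j = 0"
          using A that upper_triangularD[OF A(2), of k i]
          by cases (auto simp: word_entry_below_diagonal)
      qed
    qed (use that in auto)
    finally show ?thesis by simp
  qed
  with eq A IH show ?case by simp
qed

definition poly_mat ::
  "nat \<Rightarrow> (nat list \<Rightarrow>\<^sub>0 'a::comm_ring_1) \<Rightarrow> (nat \<Rightarrow> nat \<Rightarrow> nat \<Rightarrow> 'a) \<Rightarrow> 'a mat" where
  "poly_mat m p a = mat m m (\<lambda>(i, j). poly_entry a p i j)"

lemma eval_poly_triangular: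
  assumes p: "p \<in> free_algebra n" and A: "\<And>l. l < n \<Longrightarrow> A l \<in> triangular_mats m"
  shows "eval_poly m p A = poly_mat m p (\<lambda>l r s. A l $$ (r, s))"
proof -
  have "eval_word m A w $$ (i, j) = word_entry (\<lambda>l r s. A l $$ (r, s)) w i j"
    if "w \<in> Poly_Mapping.keys p" "i < m" "j < m" for w i j
  proof -
    have "A l \<in> triangular_mats m" if "l \<in> set w" for l
      using p A \<open>w \<in> _\<close> that unfolding free_algebra_def by blast
    then show ?thesis using eval_word_triangular[of w A m] that by blast
  qed
  then show ?thesis
    by (auto simp: eval_poly_def poly_mat_def poly_entry_def word_sum_def intro!: eq_matI sum.cong)
qed

text \<open>From here on the image is parametrised by arbitrary families of scalars: truncating such a family
below the diagonal yields triangular matrices without changing any path sum.\<close>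

lemma poly_image_eq_range:
  assumes p: "p \<in> free_algebra n"
  shows "poly_image n m p = range (poly_mat m p)"
proof (intro equalityI subsetI)
  fix M assume "M \<in> poly_image n m p"
  then show "M \<in> range (poly_mat m p)"
    using eval_poly_triangular[OF p] by (force simp: poly_image_def)
next
  fix M assume "M \<in> range (poly_mat m p)"
  then obtain a where M: "M = poly_mat m p a" by auto
  define A where "A l = mat m m (\<lambda>(i, j). if i \<le> j then a l i j else 0)" for l
  have A: "A l \<in> triangular_mats m" for l
    by (auto simp: A_def triangular_mats_def)
  have "poly_entry a p i j = poly_entry (\<lambda>l r s. A l $$ (r, s)) p i j" if "i < m" "j < m" for i j
    by (rule poly_entry_cong) (use that in \<open>auto simp: A_def\<close>)
  then have "M = poly_mat m p (\<lambda>l r s. A l $$ (r, s))"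
    unfolding M poly_mat_def by (intro eq_matI) auto
  also have "\<dots> = eval_poly m p A"
    using eval_poly_triangular[OF p] A by auto
  finally show "M \<in> poly_image n m p"
    using A by (auto simp: poly_image_def)
qed

section \<open>The order of a polynomial\<close>

lemma poly_mat_eq_0_iff: "poly_mat m p a = 0\<^sub>m m m \<longleftrightarrow> (\<forall>i<m. \<forall>j<m. poly_entry a p i j = 0)"
  by (auto simp: poly_mat_def mat_eq_iff)

lemma poly_entry_below_diagonal: "j < i \<Longrightarrow> poly_entry a p i j = 0"
  by (simp add: poly_entry_def word_sum_def word_entry_below_diagonal)

text \<open>Restricting a triangular matrix to the rows and columns \<open>i, \<dots>, j\<close> is an algebra homomorphism onto
\<open>T\<^bsub>j-i+1\<^esub>(K)\<close>, so whether an entry vanishes identically depends only on \<open>j - i\<close>.\<close>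

lemma poly_entry_interval_eq_0:
  assumes "\<And>a. poly_entry a p 0 (j - i) = 0"
  shows "poly_entry a p i j = 0"
proof (cases "i \<le> j")
  case True
  then show ?thesis
    using assms[of "\<lambda>l r s. a l (r + i) (s + i)"] by (simp add: poly_entry_shift)
qed (simp add: poly_entry_below_diagonal)

lemma poly_identity_iff:
  assumes p: "p \<in> free_algebra n" 
  shows "poly_identity n m p \<longleftrightarrow> (\<forall>k<m. \<forall>a. poly_entry a p 0 k = 0)"
proof -
  have "poly_identity n m p \<longleftrightarrow> (\<forall>a. \<forall>i<m. \<forall>j<m. poly_entry a p i j = 0)"
    unfolding poly_identity_def poly_image_eq_range[OF p] by (auto simp flip: poly_mat_eq_0_iff)
  also have "\<dots> \<longleftrightarrow> (\<forall>k<m. \<forall>a. poly_entry a p 0 k = 0)"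
  proof (intro iffI allI impI)
    fix a i j
    assume *: "\<forall>k<m. \<forall>a. poly_entry a p 0 k = 0" and "i < m" "j < m"
    show "poly_entry a p i j = 0"
      by (rule poly_entry_interval_eq_0) (use * \<open>j < m\<close> in auto)
  next
    fix a k
    assume "\<forall>a. \<forall>i<m. \<forall>j<m. poly_entry a p i j = 0" "k < m"
    then show "poly_entry a p 0 k = 0" by (cases m) auto
  qed
  finally show ?thesis .
qed

text \<open>The order is the least \<open>t\<close> such that the \<open>t\<close>-th superdiagonal does not vanish identically. In this
form order \<open>0\<close> needs no separate treatment.\<close>

lemma has_order_iff:
  assumes p: "p \<in> free_algebra n"
  shows "has_order n p t \<longleftrightarrow>
    (\<forall>k<t. \<forall>a. poly_entry a p 0 k = 0) \<and> (\<exists>a. poly_entry a p 0 t \<noteq> 0)"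
proof (cases "t = 0")
  case True
  have "poly_image n 1 p \<noteq> {0\<^sub>m 1 1} \<longleftrightarrow> \<not> poly_identity n 1 p"
    by (simp add: poly_identity_def)
  with True show ?thesis by (simp add: has_order_def poly_identity_iff[OF p])
next
  case False
  then show ?thesis
    by (auto simp: has_order_def poly_identity_iff[OF p] less_Suc_eq)
qed

lemma poly_entry_below_order:
  assumes p: "p \<in> free_algebra n" and ord: "has_order n p t" and ij: "j < i + t"
  shows "poly_entry a p i j = 0"
proof (cases "i \<le> j")
  case True
  have "poly_entry b p 0 (j - i) = 0" for b
    using ord True ij unfolding has_order_iff[OF p] by auto
  then show ?thesis by (rule poly_entry_interval_eq_0)
qed (simp add: poly_entry_below_diagonal)

lemma triangular_mats_shift_subset: "triangular_mats_shift m s \<subseteq> triangular_mats m"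
  by (auto simp: triangular_mats_shift_def)

lemma poly_image_subset_shift:
  fixes p :: "nat list \<Rightarrow>\<^sub>0 'a::comm_ring_1"
  assumes p: "p \<in> free_algebra n" and ord: "has_order n p t"
  shows "poly_image n m p \<subseteq> triangular_mats_shift m (int t - 1)"
proof
  fix M assume "M \<in> poly_image n m p"
  then obtain a where M: "M = poly_mat m p a" unfolding poly_image_eq_range[OF p] by blast
  show "M \<in> triangular_mats_shift m (int t - 1)"
    unfolding M triangular_mats_shift_def triangular_mats_def poly_mat_def
    using poly_entry_below_order[OF p ord] by (auto simp: poly_entry_below_diagonal)
qed

lemma poly_image_order_ge_size:
  fixes p :: "nat list \<Rightarrow>\<^sub>0 'a::comm_ring_1"
  assumes p: "p \<in> free_algebra n" and ord: "has_order n p t" and "m \<le> t"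
  shows "poly_image n m p = {0\<^sub>m m m}"
proof -
  have "poly_mat m p a = 0\<^sub>m m m" for a
    using poly_entry_below_order[OF p ord] \<open>m \<le> t\<close> by (simp add: poly_mat_eq_0_iff)
  then show ?thesis unfolding poly_image_eq_range[OF p] by auto
qed

section \<open>Placing single entries\<close>

text \<open>For increasing indices \<open>g 0 < \<dots> < g t\<close>, filling the rows and columns \<open>g 0, \<dots>, g t\<close> with the entries
of a matrix of size \<open>t + 1\<close> and the rest with zeros respects products: a path that leaves the range
of \<open>g\<close> meets a zero.\<close>

lemma word_entry_embed:
  assumes mono: "strict_mono_on {..t} g"
    and b: "\<And>l x y. x \<le> t \<Longrightarrow> y \<le> t \<Longrightarrow> b l (g x) (g y) = a l x y"
    and b0: "\<And>l u v. u \<notin> g ` {..t} \<or> v \<notin> g ` {..t} \<Longrightarrow> b l u v = 0"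
    and xy: "x \<le> t" "y \<le> t"
  shows "word_entry b w (g x) (g y) = word_entry a w x y"
  using xy
proof (induction w arbitrary: x)
  case Nil
  have "inj_on g {..t}" by (rule strict_mono_on_imp_inj_on[OF mono])
  with Nil show ?case by (auto simp: inj_on_def)
next
  case (Cons l w)
  have le: "g u \<le> g v \<longleftrightarrow> u \<le> v" if "u \<le> t" "v \<le> t" for u v
    using strict_mono_on_less_eq[OF mono] that by auto
  have "(\<Sum>k=g x..g y. b l (g x) k * word_entry b w k (g y)) =
      (\<Sum>k\<in>g ` {x..y}. b l (g x) k * word_entry b w k (g y))"
  proof (rule sum.mono_neutral_right)
    show "g ` {x..y} \<subseteq> {g x..g y}" using Cons.prems le by auto
    show "\<forall>k\<in>{g x..g y} - g ` {x..y}. b l (g x) k * word_entry b w k (g y) = 0"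
    proof
      fix k assume k: "k \<in> {g x..g y} - g ` {x..y}"
      have "k \<notin> g ` {..t}"
      proof
        assume "k \<in> g ` {..t}"
        then obtain v where "v \<le> t" "k = g v" by auto
        with k Cons.prems le show False by auto
      qed
      then show "b l (g x) k * word_entry b w k (g y) = 0" using b0 by simp
    qed
  qed simp
  also have "\<dots> = (\<Sum>k=x..y. b l (g x) (g k) * word_entry b w (g k) (g y))"
    using Cons.prems by (subst sum.reindex)
      (auto intro: inj_on_subset[OF strict_mono_on_imp_inj_on[OF mono]])
  also have "\<dots> = (\<Sum>k=x..y. a l x k * word_entry a w k y)"
    using Cons b by (intro sum.cong) auto
  finally show ?case by simp
qed

lemma word_entry_outside_embedding:
  assumes b0: "\<And>l. l \<in> set w \<Longrightarrow> \<forall>r s. r \<notin> S \<or> s \<notin> S \<longrightarrow> b l r s = 0"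
    and "u \<notin> S \<or> v \<notin> S" "w \<noteq> []"
  shows "word_entry b w u v = 0"
  using assms
proof (induction w arbitrary: u)
  case (Cons l w)
  have "b l u k * word_entry b w k v = 0" for k
  proof (cases "u \<in> S")
    case True
    with Cons.prems have v: "v \<notin> S" by simp
    show ?thesis
    proof (cases "w = []")
      case False
      then show ?thesis using Cons v by auto
    qed (use Cons.prems v in auto)
  qed (use Cons.prems in auto)
  then show ?case by simp
qed simp

definition single_entry_mat :: "nat \<Rightarrow> nat \<Rightarrow> nat \<Rightarrow> 'a::zero \<Rightarrow> 'a mat" where
  "single_entry_mat m i j c = mat m m (\<lambda>(r, s). if r = i \<and> s = j then c else 0)"

lemma zero_in_poly_image:
  fixes p :: "nat list \<Rightarrow>\<^sub>0 'a::comm_ring_1"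
  assumes p: "p \<in> free_algebra n" "Poly_Mapping.lookup p [] = 0"
  shows "0\<^sub>m m m \<in> poly_image n m p"
proof -
  have "word_entry (\<lambda>l r s. 0) w i j = (0 :: 'a)" if "w \<in> Poly_Mapping.keys p" for w i j
    using that p(2) by (cases w) (auto simp: in_keys_iff)
  then have "0\<^sub>m m m = poly_mat m p (\<lambda>l r s. 0)"
    by (auto simp: poly_mat_def poly_entry_def word_sum_def)
  then show ?thesis unfolding poly_image_eq_range[OF p(1)] by blast
qed

text \<open>A value of \<open>p\<close> on \<open>T\<^bsub>t+1\<^esub>(K)\<close> is a multiple of the upper right corner unit, and diagonal conjugation
turns a nonzero multiple into any other one. Embedding \<open>T\<^bsub>t+1\<^esub>(K)\<close> along \<open>t + 1\<close> indices from \<open>i\<close> to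
\<open>j\<close> moves the corner to \<open>(i, j)\<close>; as the constant term of \<open>p\<close> is zero, nothing appears outside the
embedded block.\<close>

lemma single_entry_in_poly_image:
  fixes p :: "nat list \<Rightarrow>\<^sub>0 'a::field"
  assumes p: "p \<in> free_algebra n" "Poly_Mapping.lookup p [] = 0"
    and ord: "has_order n p t" and t: "t \<ge> 1" and ij: "i + t \<le> j"
  shows "single_entry_mat m i j c \<in> poly_image n m p"
proof (cases "c = 0")
  case True
  then have "single_entry_mat m i j c = 0\<^sub>m m m" by (auto simp: single_entry_mat_def)
  then show ?thesis using zero_in_poly_image[OF p] by simp
next
  case False
  obtain a0 where a0: "poly_entry a0 p 0 t \<noteq> 0"
    using ord unfolding has_order_iff[OF p(1)] by blast
  define e where "e r = (if r = 0 then c / poly_entry a0 p 0 t else 1)" for r :: nat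
  define a where "a = (\<lambda>l r s. e r * a0 l r s / e s)"
  have "poly_entry a p 0 t = e 0 / e t * poly_entry a0 p 0 t"
    unfolding a_def by (rule poly_entry_diagonal_conjugate) (use False a0 in \<open>auto simp: e_def\<close>)
  then have at: "poly_entry a p 0 t = c" using t a0 by (simp add: e_def)
  \<comment> \<open>Any increasing choice of \<open>t + 1\<close> indices from \<open>i\<close> to \<open>j\<close> will do.\<close>
  define g where "g x = (if x < t then i + x else j)" for x
  define h where "h = inv_into {..t} g"
  define b where "b l u v = (if u \<in> g ` {..t} \<and> v \<in> g ` {..t} then a l (h u) (h v) else 0)" for l u v
  have mono: "strict_mono_on {..t} g"
    using ij by (auto simp: strict_mono_on_def g_def)
  have h: "h (g x) = x" if "x \<le> t" for x
    unfolding h_def using strict_mono_on_imp_inj_on[OF mono] that by (intro inv_into_f_f) auto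
  have inside: "poly_entry b p (g x) (g y) = poly_entry a p x y" if "x \<le> t" "y \<le> t" for x y
    unfolding poly_entry_def using that
    by (intro word_sum_cong word_entry_embed[OF mono]) (auto simp: b_def h)
  have outside: "poly_entry b p u v = 0" if "u \<notin> g ` {..t} \<or> v \<notin> g ` {..t}" for u v
  proof -
    have "word_entry b w u v = 0" if "w \<in> Poly_Mapping.keys p" for w
      using that p(2) \<open>u \<notin> g ` {..t} \<or> v \<notin> g ` {..t}\<close>
      by (intro word_entry_outside_embedding[of w "g ` {..t}"]) (auto simp: b_def in_keys_iff)
    then show ?thesis by (simp add: poly_entry_def word_sum_def)
  qed
  have gi: "g x = i \<longleftrightarrow> x = 0" if "x \<le> t" for x
    using t ij by (auto simp: g_def)
  have gj: "g x = j \<longleftrightarrow> x = t" if "x \<le> t" for x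
    using t ij that by (auto simp: g_def)
  have "poly_entry b p u v = (if u = i \<and> v = j then c else 0)" for u v
  proof (cases "u \<in> g ` {..t} \<and> v \<in> g ` {..t}")
    case True
    then obtain x y where xy: "x \<le> t" "y \<le> t" "u = g x" "v = g y" by auto
    then have "poly_entry b p u v = poly_entry a p x y" using inside by simp
    also have "\<dots> = (if x = 0 \<and> y = t then c else 0)"
      using at poly_entry_below_order[OF p(1) ord, of y x a] xy by auto
    finally show ?thesis using xy gi gj by simp
  next
    case False
    have "i = g 0" "j = g t" using t by (auto simp: g_def)
    with False have "\<not> (u = i \<and> v = j)" by auto
    moreover have "poly_entry b p u v = 0" using False by (intro outside) simp
    ultimately show ?thesis by auto
  qed
  then have "single_entry_mat m i j c = poly_mat m p b"
    by (simp add: single_entry_mat_def poly_mat_def)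
  then show ?thesis unfolding poly_image_eq_range[OF p(1)] by blast
qed

section \<open>Covering the shifted triangular matrices by single entries\<close>

lemma mat_list_sum_entry:
  assumes "\<And>B. B \<in> set Bs \<Longrightarrow> B \<in> carrier_mat m m"
  shows "mat_list_sum m Bs \<in> carrier_mat m m \<and>
    (\<forall>i<m. \<forall>j<m. mat_list_sum m Bs $$ (i, j) = (\<Sum>B\<leftarrow>Bs. B $$ (i, j)))"
  using assms
proof (induction Bs)
  case (Cons B Bs)
  then have "B \<in> carrier_mat m m" by simp
  with Cons show ?case by (auto simp: mat_list_sum_def)
qed (simp add: mat_list_sum_def)

text \<open>Every position on or above the \<open>t\<close>-th superdiagonal contributes one value supported at that
position. Listing all \<open>m\<^sup>2\<close> positions, with the value \<open>0\<close> at those below the \<open>t\<close>-th superdiagonal,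
makes the number of summands the same for all \<open>A\<close> and \<open>p\<close>.\<close>

lemma shift_mat_sum_of_values:
  fixes p :: "nat list \<Rightarrow>\<^sub>0 'a::field"
  assumes p: "p \<in> free_algebra n" "Poly_Mapping.lookup p [] = 0"
    and ord: "has_order n p t" and t: "t \<ge> 1"
    and A: "A \<in> triangular_mats_shift m (int t - 1)"
  shows "\<exists>Bs. length Bs = m * m \<and> set Bs \<subseteq> poly_image n m p \<and> A = mat_list_sum m Bs"
proof (intro exI conjI)
  define E where "E = (\<lambda>(i, j). single_entry_mat m i j (A $$ (i, j)))"
  define Bs where "Bs = map E (List.product [0..<m] [0..<m])"
  show "length Bs = m * m" by (simp add: Bs_def)
  have "E (i, j) \<in> poly_image n m p" if "i < m" "j < m" for i j
  proof (cases "i + t \<le> j")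
    case True
    then show ?thesis
      unfolding E_def using single_entry_in_poly_image[OF p ord t] by simp
  next
    case False
    then have "A $$ (i, j) = 0" using A that by (auto simp: triangular_mats_shift_def)
    then have "E (i, j) = 0\<^sub>m m m" by (auto simp: E_def single_entry_mat_def)
    then show ?thesis using zero_in_poly_image[OF p] by simp
  qed
  then show "set Bs \<subseteq> poly_image n m p" by (auto simp: Bs_def)
  have "B \<in> carrier_mat m m" if "B \<in> set Bs" for B
    using that by (auto simp: Bs_def E_def single_entry_mat_def)
  note sums = mat_list_sum_entry[of Bs m, OF this]
  have A_carrier: "A \<in> carrier_mat m m"
    using A by (auto simp: triangular_mats_shift_def triangular_mats_def)
  have "(\<Sum>B\<leftarrow>Bs. B $$ (r, s)) = A $$ (r, s)" if rs: "r < m" "s < m" for r s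
  proof -
    have "(\<Sum>B\<leftarrow>Bs. B $$ (r, s)) =
        (\<Sum>q\<in>set (List.product [0..<m] [0..<m]). E q $$ (r, s))"
      by (simp add: Bs_def comp_def sum_list_distinct_conv_sum_set distinct_product)
    also have "\<dots> = (\<Sum>q\<in>set (List.product [0..<m] [0..<m]). if q = (r, s) then A $$ (r, s) else 0)"
      using rs by (intro sum.cong) (auto simp: E_def single_entry_mat_def split: if_splits)
    also have "\<dots> = A $$ (r, s)"
      using rs by (subst sum.delta) auto
    finally show ?thesis .
  qed
  with sums A_carrier show "A = mat_list_sum m Bs" by (intro eq_matI) auto
qed

text \<open>Here the corner is the only position that is left, so single entries already give everything.\<close>

lemma poly_image_order_pred_size:
  fixes p :: "nat list \<Rightarrow>\<^sub>0 'a::field"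
  assumes p: "p \<in> free_algebra n" "Poly_Mapping.lookup p [] = 0"
    and ord: "has_order n p t" and t: "t \<ge> 1"
  shows "poly_image n (Suc t) p = triangular_mats_shift (Suc t) (int t - 1)"
proof
  show "poly_image n (Suc t) p \<subseteq> triangular_mats_shift (Suc t) (int t - 1)"
    by (rule poly_image_subset_shift[OF p(1) ord])
  show "triangular_mats_shift (Suc t) (int t - 1) \<subseteq> poly_image n (Suc t) p"
  proof
    fix A :: "'a mat" assume A: "A \<in> triangular_mats_shift (Suc t) (int t - 1)"
    have "A = single_entry_mat (Suc t) 0 t (A $$ (0, t))"
      using A by (intro eq_matI)
        (auto simp: triangular_mats_shift_def triangular_mats_def single_entry_mat_def)
    also have "\<dots> \<in> poly_image n (Suc t) p"
      by (rule single_entry_in_poly_image[OF p ord t]) simp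
    finally show "A \<in> poly_image n (Suc t) p" .
  qed
qed

section \<open>Solving for the entries above the diagonal\<close>

text \<open>The derivation of the free algebra that sends the letter \<open>l\<close> to \<open>c l\<close> and satisfies
\<open>D (u v) = x(u) D(v) + D(u) y(v)\<close>. Equivalently, it is the off-diagonal entry when the letter \<open>l\<close> is
evaluated at the \<open>2 \<times> 2\<close> matrix with diagonal \<open>x l\<close>, \<open>y l\<close> and off-diagonal entry \<open>c l\<close>.\<close>

primrec skew_derivation ::
  "(nat \<Rightarrow> 'a::comm_ring_1) \<Rightarrow> (nat \<Rightarrow> 'a) \<Rightarrow> (nat \<Rightarrow> 'a) \<Rightarrow> nat list \<Rightarrow> 'a" where
  "skew_derivation x y c [] = 0"
| "skew_derivation x y c (l # w) = x l * skew_derivation x y c w + c l * prod_list (map y w)"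

lemma skew_derivation_scale:
  "skew_derivation x y (\<lambda>l. s * c l) w = s * skew_derivation x y c w"
  by (induction w) (simp_all add: algebra_simps)

text \<open>The family \<open>y - x\<close> gives the inner derivation: the \<open>2 \<times> 2\<close> matrix in question is then conjugate to
the diagonal one.\<close>

lemma skew_derivation_difference:
  "skew_derivation x y (\<lambda>l. y l - x l) w = prod_list (map y w) - prod_list (map x w)"
proof (induction w)
  case (Cons l w)
  show ?case by (simp add: Cons.IH) (simp add: algebra_simps)
qed simp

text \<open>The argument entries at \<open>(i, j)\<close> itself enter the value at \<open>(i, j)\<close> only through paths with the
single proper step from \<open>i\<close> to \<open>j\<close>. Hence they enter linearly, and the linear form depends only on
the diagonal entries at \<open>i\<close> and \<open>j\<close>.\<close>

lemma word_entry_corner: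
  assumes ij: "i < j"
    and b: "\<And>l r s. b l r s = (if r = i \<and> s = j then 0 else a l r s)"
  shows "word_entry a w i j =
    word_entry b w i j + skew_derivation (\<lambda>l. a l i i) (\<lambda>l. a l j j) (\<lambda>l. a l i j) w"
proof (induction w)
  case (Cons l w)
  have ivl: "{i..j} = insert i (insert j {i<..<j})" using ij by auto
  have mid: "a l i k * word_entry a w k j = b l i k * word_entry b w k j" if "k \<in> {i<..<j}" for k
    using that by (intro arg_cong2[where f = times] word_entry_cong) (auto simp: b)
  have "word_entry a (l # w) i j = a l i i * word_entry a w i j + a l i j * word_entry a w j j
      + (\<Sum>k\<in>{i<..<j}. b l i k * word_entry b w k j)"
    using ij mid by (simp add: ivl)
  moreover have "word_entry b (l # w) i j = a l i i * word_entry b w i j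
      + (\<Sum>k\<in>{i<..<j}. b l i k * word_entry b w k j)"
    using ij by (simp add: ivl) (simp add: b)
  ultimately show ?case
    by (simp add: Cons.IH word_entry_diag algebra_simps)
qed (use ij in simp)

lemma poly_entry_corner:
  assumes "i < j" "\<And>l r s. b l r s = (if r = i \<and> s = j then 0 else a l r s)"
  shows "poly_entry a p i j = poly_entry b p i j +
    word_sum p (skew_derivation (\<lambda>l. a l i i) (\<lambda>l. a l j j) (\<lambda>l. a l i j))"
  unfolding poly_entry_def word_entry_corner[of i j b a, OF assms] word_sum_add ..

text \<open>By the corner formula the entry at \<open>(i, j)\<close> is an affine function of a scalar \<open>x\<close> if the arguments
there are \<open>x \<cdot> c i j\<close>. Its slope is nonzero by the second hypothesis, and its constant term
involves only arguments closer to the diagonal. So \<open>x\<close> can be solved for, superdiagonal by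
superdiagonal.\<close>

lemma poly_entry_prescribe:
  fixes p :: "nat list \<Rightarrow>\<^sub>0 'a::field"
  assumes diag: "\<And>i. i < m \<Longrightarrow> word_sum p (\<lambda>w. prod_list (map (z i) w)) = A i i"
    and nz: "\<And>i j. i < j \<Longrightarrow> j < m \<Longrightarrow> word_sum p (skew_derivation (z i) (z j) (c i j)) \<noteq> 0"
  shows "\<exists>a. \<forall>i j. i \<le> j \<longrightarrow> j < m \<longrightarrow> poly_entry a p i j = A i j"
proof -
  \<comment> \<open>After step \<open>k\<close> the entries are correct up to the \<open>k\<close>-th superdiagonal.\<close>
  have "\<exists>a. (\<forall>l i. a l i i = z i l) \<and>
      (\<forall>i j. i \<le> j \<longrightarrow> j \<le> i + k \<longrightarrow> j < m \<longrightarrow> poly_entry a p i j = A i j)" for k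
  proof (induction k)
    case 0
    show ?case
      by (rule exI[of _ "\<lambda>l i j. z i l"])
        (auto simp: le_antisym poly_entry_def word_entry_diag diag)
  next
    case (Suc k)
    then obtain a where az: "\<And>l i. a l i i = z i l"
      and a: "\<And>i j. i \<le> j \<Longrightarrow> j \<le> i + k \<Longrightarrow> j < m \<Longrightarrow> poly_entry a p i j = A i j"
      by blast
    define b where "b i j = (\<lambda>l r s. if r = i \<and> s = j then 0 else a l r s)" for i j :: nat
    define x where "x i j = (A i j - poly_entry (b i j) p i j) /
      word_sum p (skew_derivation (z i) (z j) (c i j))" for i j
    define a' where "a' l i j = (if j = i + Suc k then x i j * c i j l else a l i j)" for l i j
    have "poly_entry a' p i j = A i j" if ij: "i \<le> j" "j \<le> i + Suc k" "j < m" for i j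
    proof (cases "j = i + Suc k")
      case False
      then have "poly_entry a' p i j = poly_entry a p i j"
        using ij by (intro poly_entry_cong) (auto simp: a'_def)
      with False ij show ?thesis using a by simp
    next
      case True
      define b' where "b' l r s = (if r = i \<and> s = j then 0 else a' l r s)" for l r s
      have "poly_entry b' p i j = poly_entry (b i j) p i j"
        using True by (intro poly_entry_cong) (auto simp: b'_def b_def a'_def)
      moreover have "poly_entry a' p i j = poly_entry b' p i j +
          word_sum p (skew_derivation (\<lambda>l. a' l i i) (\<lambda>l. a' l j j) (\<lambda>l. a' l i j))"
        using True by (intro poly_entry_corner) (auto simp: b'_def)
      moreover have "(\<lambda>l. a' l i i) = z i" "(\<lambda>l. a' l j j) = z j"
          "(\<lambda>l. a' l i j) = (\<lambda>l. x i j * c i j l)"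
        using True by (auto simp: a'_def az)
      moreover have "word_sum p (skew_derivation (z i) (z j) (\<lambda>l. x i j * c i j l)) =
          x i j * word_sum p (skew_derivation (z i) (z j) (c i j))"
        unfolding word_sum_cmult[symmetric] by (intro word_sum_cong skew_derivation_scale)
      ultimately have "poly_entry a' p i j = poly_entry (b i j) p i j +
          x i j * word_sum p (skew_derivation (z i) (z j) (c i j))"
        by simp
      then show ?thesis using nz[of i j] True ij by (simp add: x_def)
    qed
    moreover have "\<forall>l i. a' l i i = z i l" by (simp add: a'_def az)
    ultimately show ?case by blast
  qed
  from this[of m] show ?thesis by (metis add.commute le_add1 less_imp_le order_trans)
qed

lemma poly_image_prescribe:
  fixes p :: "nat list \<Rightarrow>\<^sub>0 'a::field"
  assumes p: "p \<in> free_algebra n" and A: "A \<in> triangular_mats m"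
    and diag: "\<And>i. i < m \<Longrightarrow> word_sum p (\<lambda>w. prod_list (map (z i) w)) = A $$ (i, i)"
    and nz: "\<And>i j. i < j \<Longrightarrow> j < m \<Longrightarrow> word_sum p (skew_derivation (z i) (z j) (c i j)) \<noteq> 0"
  shows "A \<in> poly_image n m p"
proof -
  obtain a where a: "\<And>i j. i \<le> j \<Longrightarrow> j < m \<Longrightarrow> poly_entry a p i j = A $$ (i, j)"
    using poly_entry_prescribe[of m p z "\<lambda>i j. A $$ (i, j)" c] diag nz by blast
  have "A = poly_mat m p a"
  proof (rule eq_matI)
    fix i j assume "i < dim_row (poly_mat m p a)" "j < dim_col (poly_mat m p a)"
    then have ij: "i < m" "j < m" by (auto simp: poly_mat_def)
    show "A $$ (i, j) = poly_mat m p a $$ (i, j)"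
    proof (cases "i \<le> j")
      case False
      then show ?thesis
        using ij A by (auto simp: poly_mat_def poly_entry_below_diagonal triangular_mats_def)
    qed (use ij a in \<open>simp add: poly_mat_def\<close>)
  qed (use A in \<open>auto simp: poly_mat_def triangular_mats_def\<close>)
  then show ?thesis unfolding poly_image_eq_range[OF p] by blast
qed

section \<open>Polynomial functions in one variable\<close>

text \<open>All arguments about generic points are made along lines, where they reduce to the finiteness of the
set of roots of a polynomial in one variable.\<close>

definition is_poly_fun :: "('a::comm_ring_1 \<Rightarrow> 'a) \<Rightarrow> bool" where
  "is_poly_fun f \<longleftrightarrow> (\<exists>q. \<forall>s. f s = poly q s)"

lemma is_poly_fun_const: "is_poly_fun (\<lambda>s. c)"
  unfolding is_poly_fun_def by (rule exI[of _ "[:c:]"]) simp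

lemma is_poly_fun_id: "is_poly_fun (\<lambda>s. s)"
  unfolding is_poly_fun_def by (rule exI[of _ "[:0, 1:]"]) simp

lemma is_poly_fun_add: "is_poly_fun f \<Longrightarrow> is_poly_fun g \<Longrightarrow> is_poly_fun (\<lambda>s. f s + g s)"
  unfolding is_poly_fun_def by (metis poly_add)

lemma is_poly_fun_mult: "is_poly_fun f \<Longrightarrow> is_poly_fun g \<Longrightarrow> is_poly_fun (\<lambda>s. f s * g s)"
  unfolding is_poly_fun_def by (metis poly_mult)

lemmas is_poly_fun_intros = is_poly_fun_const is_poly_fun_id is_poly_fun_add is_poly_fun_mult

lemma is_poly_fun_sum: "(\<And>x. x \<in> S \<Longrightarrow> is_poly_fun (f x)) \<Longrightarrow> is_poly_fun (\<lambda>s. \<Sum>x\<in>S. f x s)"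
  by (induction S rule: infinite_finite_induct) (auto intro: is_poly_fun_intros)

lemma is_poly_fun_word_sum:
  "(\<And>w. is_poly_fun (f w)) \<Longrightarrow> is_poly_fun (\<lambda>s. word_sum p (\<lambda>w. f w s))"
  unfolding word_sum_def by (intro is_poly_fun_sum is_poly_fun_mult is_poly_fun_const)

lemma is_poly_fun_prod_list:
  "(\<And>l. is_poly_fun (\<lambda>s. x s l)) \<Longrightarrow> is_poly_fun (\<lambda>s. prod_list (map (x s) w))"
  by (induction w) (auto intro: is_poly_fun_intros)

lemma is_poly_fun_skew_derivation:
  assumes "\<And>l. is_poly_fun (\<lambda>s. x s l)" "\<And>l. is_poly_fun (\<lambda>s. y s l)"
  shows "is_poly_fun (\<lambda>s. skew_derivation (x s) (y s) c w)"
  by (induction w) (auto intro!: is_poly_fun_intros is_poly_fun_prod_list assms)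

lemma is_poly_fun_finite_zeros:
  fixes f :: "'a::idom \<Rightarrow> 'a"
  assumes "is_poly_fun f" "f s0 \<noteq> 0"
  shows "finite {s. f s = 0}"
proof -
  obtain q where q: "\<And>s. f s = poly q s" using assms(1) by (auto simp: is_poly_fun_def)
  with assms(2) have "q \<noteq> 0" by auto
  then show ?thesis using poly_roots_finite[of q] by (simp add: q)
qed

text \<open>Over a finite field \<open>\<Prod>\<^sub>a (X - a) + 1\<close> would be a polynomial of positive degree without roots.\<close>

lemma infinite_UNIV_alg_closed: "infinite (UNIV :: 'a::alg_closed_field set)"
proof
  assume fin: "finite (UNIV :: 'a set)"
  define q :: "'a poly" where "q = (\<Prod>a\<in>UNIV. [:-a, 1:])"
  have "degree q = card (UNIV :: 'a set)"
    unfolding q_def by (subst degree_prod_eq_sum_degree) auto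
  then have "degree q > 0" using fin by (simp add: card_gt_0_iff)
  then have "degree (q + 1) > 0"
    by (subst degree_add_eq_left) auto
  then obtain x where x: "poly (q + 1) x = 0"
    using alg_closed_imp_poly_has_root by blast
  have "poly q x = (\<Prod>a\<in>UNIV. x - a)"
    unfolding q_def poly_prod by simp
  also have "\<dots> = 0" using fin by (subst prod_zero_iff) auto
  finally show False using x by simp
qed

lemma is_poly_fun_surj:
  fixes f :: "'a::alg_closed_field \<Rightarrow> 'a"
  assumes "is_poly_fun f" "f x \<noteq> f y"
  shows "\<exists>s. f s = c"
proof -
  obtain q where q: "\<And>s. f s = poly q s" using assms(1) by (auto simp: is_poly_fun_def)
  have "degree (q - [:c:]) > 0"
  proof (rule ccontr)
    assume "\<not> degree (q - [:c:]) > 0"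
    then obtain e where "q - [:c:] = [:e:]" by (auto elim: degree_eq_zeroE)
    then have "\<And>s. poly (q - [:c:]) s = e" by simp
    then have "poly q x = poly q y" by (simp add: algebra_simps) 
    with assms(2) q show False by simp
  qed
  then obtain s where "poly (q - [:c:]) s = 0"
    using alg_closed_imp_poly_has_root by blast
  then show ?thesis using q by (intro exI[of _ s]) simp
qed

text \<open>The terms can be chosen one after the other. Keeping \<open>R (s i) t0 \<noteq> 0\<close> along the way ensures that
\<open>R (s i)\<close> is a nonzero polynomial function for each \<open>s i\<close> already chosen, so that every step excludes
only finitely many values.\<close>

lemma generic_sequence:
  fixes R :: "'a::idom \<Rightarrow> 'a \<Rightarrow> 'a" and m :: nat
  assumes inf: "infinite (UNIV :: 'a set)"
    and left: "\<And>t. is_poly_fun (\<lambda>s. R s t)" and right: "\<And>s. is_poly_fun (R s)"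
    and nz: "R s0 t0 \<noteq> 0"
  shows "\<exists>s. \<forall>i j. i < j \<longrightarrow> j < m \<longrightarrow> R (s i) (s j) \<noteq> 0"
proof -
  have "\<exists>s. (\<forall>i<m. R (s i) t0 \<noteq> 0) \<and> (\<forall>i j. i < j \<longrightarrow> j < m \<longrightarrow> R (s i) (s j) \<noteq> 0)"
  proof (induction m)
    case (Suc m)
    then obtain s where s: "\<And>i. i < m \<Longrightarrow> R (s i) t0 \<noteq> 0"
      "\<And>i j. i < j \<Longrightarrow> j < m \<Longrightarrow> R (s i) (s j) \<noteq> 0"
      by blast
    have "finite ({x. R x t0 = 0} \<union> (\<Union>i<m. {x. R (s i) x = 0}))"
      using is_poly_fun_finite_zeros[OF left nz] is_poly_fun_finite_zeros[OF right s(1)] by auto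
    then obtain x where "x \<notin> {x. R x t0 = 0} \<union> (\<Union>i<m. {x. R (s i) x = 0})"
      using ex_new_if_finite[OF inf] by blast
    then have x: "R x t0 \<noteq> 0" "\<And>i. i < m \<Longrightarrow> R (s i) x \<noteq> 0" by auto
    show ?case
      by (rule exI[of _ "s(m := x)"]) (use s x in \<open>auto simp: less_Suc_eq\<close>)
  qed simp
  then show ?thesis by blast
qed

section \<open>Order one\<close>

text \<open>Since \<open>p\<close> is not an identity of \<open>T\<^sub>2(K)\<close>, its skew derivation is nonzero for some pair of points of
\<open>K\<^sup>n\<close> and some \<open>c\<close>. On the line through these two points \<open>m\<close> points can be found such that it is
nonzero for every two of them, with the same \<open>c\<close>. These serve as the diagonal entries of the
arguments.\<close>

lemma poly_image_order_one:
  fixes p :: "nat list \<Rightarrow>\<^sub>0 'a::alg_closed_field"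
  assumes p: "p \<in> free_algebra n" and ord: "has_order n p 1"
  shows "poly_image n m p = triangular_mats_shift m 0"
proof
  show "poly_image n m p \<subseteq> triangular_mats_shift m 0"
    using poly_image_subset_shift[OF p ord] by simp
  obtain a where a: "poly_entry a p 0 1 \<noteq> 0" and diag: "\<And>b. poly_entry b p 0 0 = 0"
    using ord unfolding has_order_iff[OF p] by auto
  define c where "c = (\<lambda>l. a l 0 1)"
  define z where "z s l = a l 0 0 + s * (a l 1 1 - a l 0 0)" for s l
  define R where "R s t = word_sum p (skew_derivation (z s) (z t) c)" for s t
  \<comment> \<open>Setting the corner to zero leaves diagonal arguments, so the whole entry is the derivation.\<close>
  define b where "b = (\<lambda>l r s. if r = 0 \<and> s = 1 then 0 else a l r s)"
  have "word_entry b w 0 1 = 0" for w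
    by (induction w) (auto simp: b_def)
  then have "poly_entry b p 0 1 = 0" by (simp add: poly_entry_def word_sum_def)
  moreover have "poly_entry a p 0 1 = poly_entry b p 0 1 + R 0 1"
    unfolding R_def z_def c_def by (subst poly_entry_corner[of 0 1 b a]) (auto simp: b_def)
  ultimately have R01: "R 0 1 \<noteq> 0" using a by simp
  have z: "is_poly_fun (\<lambda>s. z s l)" for l
    unfolding z_def by (intro is_poly_fun_intros)
  have left: "is_poly_fun (\<lambda>s. R s t)" for t
    unfolding R_def
    by (rule is_poly_fun_word_sum, rule is_poly_fun_skew_derivation, rule z, rule is_poly_fun_const)
  have right: "is_poly_fun (\<lambda>s. R t s)" for t
    unfolding R_def
    by (rule is_poly_fun_word_sum, rule is_poly_fun_skew_derivation, rule is_poly_fun_const, rule z)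
  obtain s where "\<forall>i j. i < j \<longrightarrow> j < m \<longrightarrow> R (s i) (s j) \<noteq> 0"
    using generic_sequence[of R, OF infinite_UNIV_alg_closed left right R01] ..
  then have s: "R (s i) (s j) \<noteq> 0" if "i < j" "j < m" for i j using that by simp
  show "triangular_mats_shift m 0 \<subseteq> poly_image n m p"
  proof
    fix A :: "'a mat" assume A: "A \<in> triangular_mats_shift m 0"
    have scalar: "word_sum p (\<lambda>w. prod_list (map x w)) = 0" for x
      using diag[of "\<lambda>l r s. x l"] by (simp add: poly_entry_def word_entry_diag)
    show "A \<in> poly_image n m p"
    proof (rule poly_image_prescribe[OF p])
      show "word_sum p (\<lambda>w. prod_list (map (z (s i)) w)) = A $$ (i, i)" if "i < m" for i
        using A that by (simp add: scalar triangular_mats_shift_def)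
      show "word_sum p (skew_derivation (z (s i)) (z (s j)) c) \<noteq> 0" if "i < j" "j < m" for i j
        using s[OF that] by (simp add: R_def)
    qed (use A triangular_mats_shift_subset in blast)
  qed
qed

section \<open>Order zero\<close>

text \<open>On a line through the origin and a point where \<open>p\<close> does not vanish, \<open>p\<close> is a polynomial function that
is zero at \<open>0\<close> but not constant; hence it is onto.\<close>

lemma order_zero_scalar_surj:
  fixes p :: "nat list \<Rightarrow>\<^sub>0 'a::alg_closed_field"
  assumes p: "p \<in> free_algebra n" "Poly_Mapping.lookup p [] = 0" and ord: "has_order n p 0"
  shows "\<exists>z. word_sum p (\<lambda>w. prod_list (map z w)) = c"
proof -
  obtain a where a: "poly_entry a p 0 0 \<noteq> 0"
    using ord unfolding has_order_iff[OF p(1)] by blast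
  define f where "f s = word_sum p (\<lambda>w. prod_list (map (\<lambda>l. s * a l 0 0) w))" for s
  have "is_poly_fun f"
    unfolding f_def
    by (rule is_poly_fun_word_sum, rule is_poly_fun_prod_list) (intro is_poly_fun_intros)
  moreover have "f 1 \<noteq> 0"
    using a by (simp add: f_def poly_entry_def word_entry_diag)
  moreover have "prod_list (map (\<lambda>l. 0 * a l 0 0) w) = 0" if "w \<in> Poly_Mapping.keys p" for w
    using that p(2) by (cases w) (auto simp: in_keys_iff)
  then have "f 0 = 0" by (simp add: f_def word_sum_def)
  ultimately obtain s where "f s = c" using is_poly_fun_surj[of f 1 0 c] by auto
  then show ?thesis unfolding f_def by blast
qed

text \<open>Choose scalar points \<open>z i\<close> at which \<open>p\<close> takes the given diagonal values. The inner derivation between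
two of them has the value \<open>A\<^sub>j\<^sub>j - A\<^sub>i\<^sub>i\<close>, so the hypothesis is just what makes the entries above the
diagonal solvable.\<close>

lemma distinct_diagonal_in_poly_image:
  fixes p :: "nat list \<Rightarrow>\<^sub>0 'a::alg_closed_field"
  assumes p: "p \<in> free_algebra n" "Poly_Mapping.lookup p [] = 0" and ord: "has_order n p 0"
    and A: "A \<in> triangular_mats m"
    and dist: "\<And>i j. i < j \<Longrightarrow> j < m \<Longrightarrow> A $$ (i, i) \<noteq> A $$ (j, j)"
  shows "A \<in> poly_image n m p"
proof -
  have "\<forall>i. \<exists>z. word_sum p (\<lambda>w. prod_list (map z w)) = A $$ (i, i)"
    by (intro allI order_zero_scalar_surj[OF p ord])
  from choice[OF this] obtain z
    where z: "word_sum p (\<lambda>w. prod_list (map (z i) w)) = A $$ (i, i)" for i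
    by blast
  show ?thesis
  proof (rule poly_image_prescribe[OF p(1) A z])
    show "word_sum p (skew_derivation (z i) (z j) (\<lambda>l. z j l - z i l)) \<noteq> 0"
      if "i < j" "j < m" for i j
    proof -
      have "word_sum p (skew_derivation (z i) (z j) (\<lambda>l. z j l - z i l)) =
          word_sum p (\<lambda>w. prod_list (map (z j) w) - prod_list (map (z i) w))"
        by (intro word_sum_cong skew_derivation_difference)
      also have "\<dots> = A $$ (j, j) - A $$ (i, i)"
        unfolding word_sum_diff z ..
      finally show ?thesis using dist[OF that] by simp
    qed
  qed
qed

lemma entry_poly_on_diagonal_line:
  assumes "f \<in> entry_polys m"
  shows "is_poly_fun (\<lambda>s. f (mat m m (\<lambda>(i, j). A $$ (i, j) + s * (if i = j then d i else 0))))"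
  using assms
proof induction
  case (entry i j)
  then show ?case by (auto intro!: is_poly_fun_intros)
qed (auto intro: is_poly_fun_intros)

text \<open>Adding multiples \<open>s \<cdot> D\<close> of a diagonal matrix with distinct diagonal entries to any \<open>A\<close> gives a matrix
with distinct diagonal entries for all but finitely many \<open>s\<close>. A polynomial in the entries that
vanishes on these matrices vanishes on the whole line, in particular at \<open>A\<close>.\<close>

lemma zariski_dense_if_distinct_diagonals:
  fixes X :: "'a::alg_closed_field mat set"
  assumes X: "X \<subseteq> triangular_mats m"
    and dist: "\<And>A. A \<in> triangular_mats m \<Longrightarrow>
      (\<And>i j. i < j \<Longrightarrow> j < m \<Longrightarrow> A $$ (i, i) \<noteq> A $$ (j, j)) \<Longrightarrow> A \<in> X"
  shows "zariski_dense m X"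
proof -
  let ?C = "Abstract_Topology.closure_of (zariski_topology m) X"
  have "closedin (zariski_topology m) ?C" by simp
  then obtain F where F: "F \<subseteq> entry_polys m" "?C = zero_locus m F"
    unfolding closedin_zariski_topology by blast
  have "X \<subseteq> zero_locus m F"
    using closure_of_subset[of X "zariski_topology m"] X F(2) by simp
  obtain d :: "nat \<Rightarrow> 'a" where d: "inj d"
    using infinite_countable_subset[OF infinite_UNIV_alg_closed] by blast
  have "f A = 0" if f: "f \<in> F" and A: "A \<in> triangular_mats m" for f A
  proof (rule ccontr)
    assume fA: "f A \<noteq> 0"
    define B where "B s = mat m m (\<lambda>(i, j). A $$ (i, j) + s * (if i = j then d i else 0))" for s
    have "B 0 = A" using A by (auto simp: B_def triangular_mats_def intro!: eq_matI)
    with fA have "f (B 0) \<noteq> 0" by simp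
    moreover have "is_poly_fun (\<lambda>s. f (B s))"
      unfolding B_def using F f by (intro entry_poly_on_diagonal_line) blast
    ultimately have "finite {s. f (B s) = 0}" by (intro is_poly_fun_finite_zeros)
    define E where "E i j = {s. (A $$ (i, i) - A $$ (j, j)) + s * (d i - d j) = 0}" for i j
    have "finite (E i j)" if "i < j" for i j
    proof -
      have "d i - d j \<noteq> 0" using d that by (auto dest: injD)
      then have "E i j \<subseteq> {- (A $$ (i, i) - A $$ (j, j)) / (d i - d j)}"
        by (auto simp: E_def field_simps)
      then show ?thesis by (rule finite_subset) simp
    qed
    then have "finite ({s. f (B s) = 0} \<union> (\<Union>j<m. \<Union>i<j. E i j))"
      using \<open>finite {s. f (B s) = 0}\<close> by auto
    then obtain s where "s \<notin> {s. f (B s) = 0} \<union> (\<Union>j<m. \<Union>i<j. E i j)"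
      using ex_new_if_finite[OF infinite_UNIV_alg_closed] by blast
    then have s: "f (B s) \<noteq> 0" "\<And>i j. i < j \<Longrightarrow> j < m \<Longrightarrow> s \<notin> E i j" by auto
    have "B s \<in> X"
    proof (rule dist)
      show "B s \<in> triangular_mats m"
        using A unfolding B_def triangular_mats_def by (intro CollectI conjI upper_triangularI) auto
      show "B s $$ (i, i) \<noteq> B s $$ (j, j)" if "i < j" "j < m" for i j
        using s(2)[OF that] that by (auto simp: B_def E_def algebra_simps)
    qed
    then have "f (B s) = 0" using \<open>X \<subseteq> zero_locus m F\<close> f by (auto simp: zero_locus_def)
    with s(1) show False by simp
  qed
  then have "zero_locus m F = triangular_mats m" by (auto simp: zero_locus_def)
  with F(2) show ?thesis by (simp add: zariski_dense_def)
qed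

lemma poly_image_order_zero_dense:
  fixes p :: "nat list \<Rightarrow>\<^sub>0 'a::alg_closed_field"
  assumes p: "p \<in> free_algebra n" "Poly_Mapping.lookup p [] = 0" and ord: "has_order n p 0"
  shows "zariski_dense m (poly_image n m p)"
proof (rule zariski_dense_if_distinct_diagonals)
  show "poly_image n m p \<subseteq> triangular_mats m"
    using poly_image_subset_shift[OF p(1) ord] triangular_mats_shift_subset by blast
qed (rule distinct_diagonal_in_poly_image[OF p ord])

lemma poly_image_order_zero_size_one:
  fixes p :: "nat list \<Rightarrow>\<^sub>0 'a::alg_closed_field"
  assumes p: "p \<in> free_algebra n" "Poly_Mapping.lookup p [] = 0" and ord: "has_order n p 0"
  shows "poly_image n 1 p = triangular_mats_shift 1 (- 1)"
proof
  show "poly_image n 1 p \<subseteq> triangular_mats_shift 1 (- 1)"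
    using poly_image_subset_shift[OF p(1) ord] by simp
  show "triangular_mats_shift 1 (- 1) \<subseteq> poly_image n 1 p"
    using distinct_diagonal_in_poly_image[OF p ord, of _ 1] triangular_mats_shift_subset by fastforce
qed

section \<open>A polynomial of order two with a deficient image\<close>

text \<open>The square of the commutator \<open>x\<^sub>0 x\<^sub>1 - x\<^sub>1 x\<^sub>0\<close>. The commutator of triangular matrices is strictly
triangular, so the entries of its square on the second superdiagonal are the products
\<open>c\<^sub>0 c\<^sub>1\<close>, \<open>c\<^sub>1 c\<^sub>2\<close>, \<open>c\<^sub>2 c\<^sub>3, \<dots>\<close> of neighbours on its first superdiagonal.\<close>

definition commutator_square :: "nat list \<Rightarrow>\<^sub>0 'a::comm_ring_1" where
  "commutator_square = Poly_Mapping.single [0, 1, 0, 1] 1 - Poly_Mapping.single [0, 1, 1, 0] 1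
     - Poly_Mapping.single [1, 0, 0, 1] 1 + Poly_Mapping.single [1, 0, 1, 0] 1"

lemma keys_commutator_square:
  "Poly_Mapping.keys (commutator_square :: nat list \<Rightarrow>\<^sub>0 'a::comm_ring_1)
    \<subseteq> {[0, 1, 0, 1], [0, 1, 1, 0], [1, 0, 0, 1], [1, 0, 1, 0]}"
  by (auto simp: in_keys_iff commutator_square_def lookup_add lookup_minus lookup_single when_def
    split: if_splits)

lemma word_sum_commutator_square:
  "word_sum commutator_square f = f [0, 1, 0, 1] - f [0, 1, 1, 0] - f [1, 0, 0, 1] + f [1, 0, 1, 0]"
  by (subst word_sum_superset[OF _ keys_commutator_square])
    (auto simp: commutator_square_def lookup_add lookup_minus lookup_single when_def)

definition commutator_superdiag :: "(nat \<Rightarrow> nat \<Rightarrow> nat \<Rightarrow> 'a::comm_ring_1) \<Rightarrow> nat \<Rightarrow> 'a" where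
  "commutator_superdiag a i =
     a 0 i i * a 1 i (Suc i) + a 0 i (Suc i) * a 1 (Suc i) (Suc i)
     - a 1 i i * a 0 i (Suc i) - a 1 i (Suc i) * a 0 (Suc i) (Suc i)"

lemma poly_entry_commutator_square:
  "poly_entry a commutator_square 0 0 = 0"
  "poly_entry a commutator_square 0 (Suc 0) = 0"
  "poly_entry a commutator_square 0 (Suc (Suc 0)) = commutator_superdiag a 0 * commutator_superdiag a 1"
  unfolding poly_entry_def word_sum_commutator_square
  by (simp_all add: atLeastAtMostSuc_conv commutator_superdiag_def algebra_simps)

lemma poly_entry_commutator_square_shift:
  "poly_entry a commutator_square i (i + 2) = commutator_superdiag a i * commutator_superdiag a (i + 1)"
  using poly_entry_commutator_square(3)[of "\<lambda>l r s. a l (r + i) (s + i)"]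
  unfolding poly_entry_shift by (simp add: commutator_superdiag_def)

lemma commutator_square_free_algebra: "commutator_square \<in> free_algebra 2"
  using keys_commutator_square unfolding free_algebra_def by force

lemma commutator_square_constant_term: "Poly_Mapping.lookup commutator_square [] = 0"
  using keys_commutator_square by (force simp: in_keys_iff)

lemma has_order_commutator_square:
  "has_order 2 (commutator_square :: nat list \<Rightarrow>\<^sub>0 'a::comm_ring_1) 2"
proof -
  \<comment> \<open>The commutator of \<open>E\<^sub>1\<^sub>1\<close> with the shift matrix is \<open>E\<^sub>1\<^sub>2 - E\<^sub>0\<^sub>1\<close>, whose square is \<open>- E\<^sub>0\<^sub>2\<close>.\<close>
  define a :: "nat \<Rightarrow> nat \<Rightarrow> nat \<Rightarrow> 'a" where
    "a l r s = (if l = 0 then of_bool (r = 1 \<and> s = 1) else of_bool (s = Suc r))" for l r s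
  have "poly_entry a commutator_square 0 2 \<noteq> 0"
    using poly_entry_commutator_square_shift[of a 0] by (simp add: commutator_superdiag_def a_def numeral_2_eq_2)
  then show ?thesis
    unfolding has_order_iff[OF commutator_square_free_algebra]
    by (auto simp: less_2_cases_iff poly_entry_commutator_square)
qed

text \<open>For size \<open>5\<close> there are three such products. If \<open>c\<^sub>0 c\<^sub>1\<close> and \<open>c\<^sub>2 c\<^sub>3\<close> are nonzero then so is \<open>c\<^sub>1 c\<^sub>2\<close>,
so the pattern \<open>(1, 0, 1)\<close> is never attained.\<close>

lemma commutator_square_image_deficient:
  "poly_image 2 5 (commutator_square :: nat list \<Rightarrow>\<^sub>0 'a::idom) \<noteq> triangular_mats_shift 5 1"
proof
  assume eq: "poly_image 2 5 (commutator_square :: nat list \<Rightarrow>\<^sub>0 'a) = triangular_mats_shift 5 1"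
  define M :: "'a mat" where
    "M = mat 5 5 (\<lambda>(i, j). of_bool (i = 0 \<and> j = 2 \<or> i = 2 \<and> j = 4))"
  have "M \<in> triangular_mats_shift 5 1"
    by (auto simp: M_def triangular_mats_shift_def triangular_mats_def)
  then obtain a where a: "M = poly_mat 5 commutator_square a"
    using eq unfolding poly_image_eq_range[OF commutator_square_free_algebra] by blast
  have entry: "commutator_superdiag a i * commutator_superdiag a (i + 1) = of_bool (i \<noteq> 1)"
    if "i \<le> 2" for i
  proof -
    have "M $$ (i, i + 2) = commutator_superdiag a i * commutator_superdiag a (i + 1)"
      using that unfolding a poly_mat_def
      by (simp add: poly_entry_commutator_square_shift[simplified])
    moreover have "M $$ (i, i + 2) = of_bool (i \<noteq> 1)"
      using that by (auto simp: M_def)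
    ultimately show ?thesis by simp
  qed
  show False
    using entry[of 0] entry[of 1] entry[of 2] by (auto simp: numeral_2_eq_2)
qed

section \<open>Images according to the order\<close>

theorem theorem5p18:
  shows
    "(\<forall>m\<ge>1. \<forall>n\<ge>1. \<forall>t. \<forall>p :: nat list \<Rightarrow>\<^sub>0 'a::alg_closed_field.
        p \<in> free_algebra n \<and> Poly_Mapping.lookup p [] = 0 \<and> has_order n p t \<longrightarrow>
          (t = 0 \<longrightarrow> zariski_dense m (poly_image n m p)) \<and>
          (t = 1 \<longrightarrow> poly_image n m p = triangular_mats_shift m 0) \<and>
          (1 < t \<and> t < m - 1 \<longrightarrow> poly_image n m p \<subseteq> triangular_mats_shift m (int t - 1)) \<and>
          (t = m - 1 \<longrightarrow> poly_image n m p = triangular_mats_shift m (int m - 2)) \<and>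
          (t \<ge> m \<longrightarrow> poly_image n m p = {0\<^sub>m m m})) \<and>
     (\<exists>m\<ge>1. \<exists>n\<ge>1. \<exists>t. 1 < t \<and> t < m - 1 \<and>
        (\<exists>p :: nat list \<Rightarrow>\<^sub>0 'a.
           p \<in> free_algebra n \<and> Poly_Mapping.lookup p [] = 0 \<and> has_order n p t \<and>
           poly_image n m p \<noteq> triangular_mats_shift m (int t - 1))) \<and>
     (\<forall>m t. 1 < t \<and> t < m - 1 \<longrightarrow>
        (\<exists>d\<ge>1. \<forall>n\<ge>1. \<forall>p :: nat list \<Rightarrow>\<^sub>0 'a.
           p \<in> free_algebra n \<and> Poly_Mapping.lookup p [] = 0 \<and> has_order n p t \<longrightarrow>
           (\<forall>A \<in> triangular_mats_shift m (int t - 1).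
              \<exists>Bs. length Bs = d \<and> set Bs \<subseteq> poly_image n m p \<and> A = mat_list_sum m Bs)))"
  (is "?images \<and> ?deficient \<and> ?sums")
proof (intro conjI)
  show ?images
  proof (intro allI impI, elim conjE, intro conjI impI)
    fix m n t :: nat and p :: "nat list \<Rightarrow>\<^sub>0 'a"
    assume m: "m \<ge> 1" and p: "p \<in> free_algebra n" "Poly_Mapping.lookup p [] = 0"
      and ord: "has_order n p t"
    show "zariski_dense m (poly_image n m p)" if "t = 0"
      using poly_image_order_zero_dense[OF p] ord that by simp
    show "poly_image n m p = triangular_mats_shift m 0" if "t = 1"
      using poly_image_order_one[OF p(1)] ord that by simp
    show "poly_image n m p \<subseteq> triangular_mats_shift m (int t - 1)"
      by (rule poly_image_subset_shift[OF p(1) ord])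
    show "poly_image n m p = triangular_mats_shift m (int m - 2)" if t: "t = m - 1"
    proof (cases "t = 0")
      case True
      with t m have "m = 1" by simp
      with True show ?thesis using poly_image_order_zero_size_one[OF p] ord by simp
    next
      case False
      with t have "m = Suc t" by simp
      with False show ?thesis using poly_image_order_pred_size[OF p ord] by simp
    qed
    show "poly_image n m p = {0\<^sub>m m m}" if "m \<le> t"
      by (rule poly_image_order_ge_size[OF p(1) ord that])
  qed
  have "poly_image 2 5 (commutator_square :: nat list \<Rightarrow>\<^sub>0 'a) \<noteq> triangular_mats_shift 5 (int 2 - 1)"
    using commutator_square_image_deficient by simp
  then show ?deficient
    using commutator_square_free_algebra commutator_square_constant_term has_order_commutator_square
    by (intro exI[of _ "5::nat"] exI[of _ "2::nat"] exI[of _ commutator_square] conjI) simp_all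
  show ?sums
  proof (intro allI impI, elim conjE)
    fix m t :: nat assume "1 < t" "t < m - 1"
    then have "m * m \<ge> 1" "t \<ge> 1" by auto
    then show "\<exists>d\<ge>1. \<forall>n\<ge>1. \<forall>p :: nat list \<Rightarrow>\<^sub>0 'a.
           p \<in> free_algebra n \<and> Poly_Mapping.lookup p [] = 0 \<and> has_order n p t \<longrightarrow>
           (\<forall>A \<in> triangular_mats_shift m (int t - 1).
              \<exists>Bs. length Bs = d \<and> set Bs \<subseteq> poly_image n m p \<and> A = mat_list_sum m Bs)"
      using shift_mat_sum_of_values[of _ _ t _ m] by (intro exI[of _ "m * m"]) blast
  qed
qed

end
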